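(* Let $K$ be a polyhedral map on a surface $S$ with $n$ vertices, and let $M$ be its dual map. Then the edge graph $EG(K)$ has a non-separating Hamiltonian cycle if and only if the edge graph $EG(M)$ of the dual map contains a proper graph of type-I (with respect to $n$).
   Context: A surface is a connected compact 2-manifold without boundary. A map on a surface $S$ is an embedding of a finite simple graph in $S$ such that the closure of each component of the complement is a $p$-gonal 2-disc ($p\ge 3$); these are the faces. A map is polyhedral if any two faces intersect in the empty set, a single vertex, or a single edge. $EG(K)$ denotes the edge graph (vertices and edges) of a map $K$. The dual map $M$ of $K$ is a map on the same surface with a vertex for each face of $K$ and, for each edge $e$ of $K$, an edge (the dual of $e$) joining the vertices corresponding to the two faces of $K$ containing $e$; faces of $M$ correspond to vertices of $K$. Write $V_M,E_M,F_M$ for the vertex, edge and face sets of $M$. For a face $F$ of $M$ and a set $E$ of edges, $F\cap E$ denotes the set of edges of $E$ lying on the boundary of $F$. A cycle of $EG(K)$, viewed as a closed curve in $S$, is separating if its complement in $S$ is disconnected and non-separating otherwise. Let $K$ have $n$ vertices and $M$ be its dual. A subgraph $G=(V,E)$ of $EG(M)=(V_M,E_M)$ is admissible if: (1) $|E|=n$; (2) for each face $F\in F_M$, $F\cap E$ consists of exactly two edges of $E$; (3) there is a finite sequence of $n$ faces $F_1,\dots,F_n$ of $M$ with $F_i\cap F_{i+1}\in E$ for $1\le i\le n-1$ and $F_1\cap F_n\in E$. An admissible graph $G$ is a proper graph of type-I if the graph $H=(V_M,E_M\setminus E)$ is connected. *)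

theory Defs
  imports "HOL-Analysis.Analysis"
begin

definition surface :: "'a topology \<Rightarrow> bool" where
  "surface S \<longleftrightarrow>
     topspace S \<noteq> {} \<and> connected_space S \<and> compact_space S \<and> Hausdorff_space S \<and> second_countable S \<and>
     (\<forall>x\<in>topspace S. \<exists>U W. openin S U \<and> x \<in> U \<and> open (W :: (real^2) set) \<and>
        subtopology S U homeomorphic_space top_of_set W)"

text \<open>An embedded graph is identified with its image: vertices are points, and an edge is the set
  of points of a closed arc. The end vertices of an edge \<open>e\<close> are then \<open>e \<inter> verts K\<close>.\<close>

record 'a egraph =
  verts :: "'a set"
  edges :: "'a set set"

definition ends :: "'a egraph \<Rightarrow> 'a set \<Rightarrow> 'a set" where
  "ends K e = e \<inter> verts K"

definition skeleton :: "'a egraph \<Rightarrow> 'a set" where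
  "skeleton K = verts K \<union> \<Union>(edges K)"

text \<open>The arcs are injective, so there are no loops; the last clause excludes multiple edges.\<close>

definition embedded_simple_graph :: "'a topology \<Rightarrow> 'a egraph \<Rightarrow> bool" where
  "embedded_simple_graph S K \<longleftrightarrow>
     finite (verts K) \<and> verts K \<subseteq> topspace S \<and> finite (edges K) \<and>
     (\<forall>e\<in>edges K. \<exists>g. embedding_map (top_of_set {0..1::real}) S g \<and>
        e = g ` {0..1} \<and> ends K e = {g 0, g 1}) \<and>
     (\<forall>e\<in>edges K. \<forall>e'\<in>edges K. e \<noteq> e' \<longrightarrow> e \<inter> e' \<subseteq> verts K) \<and>
     (\<forall>e\<in>edges K. \<forall>e'\<in>edges K. ends K e = ends K e' \<longrightarrow> e = e')"

definition graph_cycle :: "'a egraph \<Rightarrow> 'a list \<Rightarrow> bool" where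
  "graph_cycle K vs \<longleftrightarrow>
     length vs \<ge> 3 \<and> distinct vs \<and> set vs \<subseteq> verts K \<and>
     (\<forall>i<length vs. \<exists>e\<in>edges K. ends K e = {vs ! i, vs ! (Suc i mod length vs)})"

definition cycle_edges :: "'a egraph \<Rightarrow> 'a list \<Rightarrow> 'a set set" where
  "cycle_edges K vs =
     {e \<in> edges K. \<exists>i<length vs. ends K e = {vs ! i, vs ! (Suc i mod length vs)}}"

definition hamiltonian_cycle :: "'a egraph \<Rightarrow> 'a list \<Rightarrow> bool" where
  "hamiltonian_cycle K vs \<longleftrightarrow> graph_cycle K vs \<and> set vs = verts K"

definition cycle_curve :: "'a egraph \<Rightarrow> 'a list \<Rightarrow> 'a set" where
  "cycle_curve K vs = \<Union>(cycle_edges K vs)"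

definition separating :: "'a topology \<Rightarrow> 'a egraph \<Rightarrow> 'a list \<Rightarrow> bool" where
  "separating S K vs \<longleftrightarrow> \<not> connectedin S (topspace S - cycle_curve K vs)"

definition open_cells :: "'a topology \<Rightarrow> 'a egraph \<Rightarrow> 'a set set" where
  "open_cells S K = connected_components_of (subtopology S (topspace S - skeleton K))"

text \<open>A \<open>p\<close>-gonal disc is a closed disc whose boundary circle is a cycle of length \<open>p\<close> of the
  graph; \<open>p\<close> may depend on the cell.\<close>

definition polygonal_disc_cell :: "'a topology \<Rightarrow> 'a egraph \<Rightarrow> nat \<Rightarrow> 'a set \<Rightarrow> bool" where
  "polygonal_disc_cell S K p C \<longleftrightarrow>
     (\<exists>h vs. homeomorphic_map (top_of_set (cball (0::real^2) 1)) (subtopology S (S closure_of C)) h \<and>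
        h ` ball 0 1 = C \<and>
        graph_cycle K vs \<and> length vs = p \<and> h ` sphere 0 1 = cycle_curve K vs)"

definition surface_map :: "'a topology \<Rightarrow> 'a egraph \<Rightarrow> bool" where
  "surface_map S K \<longleftrightarrow>
     embedded_simple_graph S K \<and> (\<forall>C\<in>open_cells S K. \<exists>p\<ge>3. polygonal_disc_cell S K p C)"

definition faces :: "'a topology \<Rightarrow> 'a egraph \<Rightarrow> 'a set set" where
  "faces S K = (\<lambda>C. S closure_of C) ` open_cells S K"

text \<open>The open cell of a face misses the graph and the rest of the face lies in it, so this is the
  boundary circle of the disc \<open>F\<close>.\<close>

definition face_boundary :: "'a egraph \<Rightarrow> 'a set \<Rightarrow> 'a set" where
  "face_boundary K F = F \<inter> skeleton K"

definition polyhedral_map :: "'a topology \<Rightarrow> 'a egraph \<Rightarrow> bool" where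
  "polyhedral_map S K \<longleftrightarrow>
     surface_map S K \<and>
     (\<forall>F\<in>faces S K. \<forall>F'\<in>faces S K. F \<noteq> F' \<longrightarrow>
        F \<inter> F' = {} \<or> (\<exists>v\<in>verts K. F \<inter> F' = {v}) \<or> F \<inter> F' \<in> edges K)"

text \<open>\<open>\<phi>\<close> sends a face of \<open>K\<close> to its vertex in \<open>M\<close>, \<open>\<delta>\<close> an edge to its dual edge and \<open>\<psi>\<close> a
  vertex to its face in \<open>M\<close>. The two ends of \<open>\<delta> e\<close> are the vertices of the faces containing \<open>e\<close>,
  and the dual edges around the face \<open>\<psi> v\<close> are those of the edges at \<open>v\<close>. Duality is an
  incidence condition: \<open>M\<close> need not be drawn with its vertices inside the faces of \<open>K\<close>.\<close>

definition dual_map :: "'a topology \<Rightarrow> 'a egraph \<Rightarrow> 'a egraph \<Rightarrow> bool" where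
  "dual_map S K M \<longleftrightarrow>
     surface_map S M \<and>
     (\<exists>\<phi> \<delta> \<psi>.
        bij_betw \<phi> (faces S K) (verts M) \<and>
        bij_betw \<delta> (edges K) (edges M) \<and>
        bij_betw \<psi> (verts K) (faces S M) \<and>
        (\<forall>e\<in>edges K. ends M (\<delta> e) = \<phi> ` {F \<in> faces S K. e \<subseteq> face_boundary K F}) \<and>
        (\<forall>e\<in>edges K. \<forall>v\<in>verts K. \<delta> e \<subseteq> face_boundary M (\<psi> v) \<longleftrightarrow> v \<in> ends K e))"

definition egraph_connected :: "'a egraph \<Rightarrow> bool" where
  "egraph_connected G \<longleftrightarrow>
     (\<forall>u\<in>verts G. \<forall>v\<in>verts G. (\<lambda>x y. \<exists>e\<in>edges G. ends G e = {x, y})\<^sup>*\<^sup>* u v)"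

definition subgraph_of :: "'a egraph \<Rightarrow> 'a egraph \<Rightarrow> bool" where
  "subgraph_of G M \<longleftrightarrow>
     verts G \<subseteq> verts M \<and> edges G \<subseteq> edges M \<and> (\<forall>e\<in>edges G. ends M e \<subseteq> verts G)"

text \<open>The faces \<open>F\<^sub>1, \<dots>, F\<^sub>n\<close> are pairwise distinct; otherwise the sequence could run back and
  forth between two faces.\<close>

definition admissible :: "'a topology \<Rightarrow> 'a egraph \<Rightarrow> nat \<Rightarrow> 'a egraph \<Rightarrow> bool" where
  "admissible S M n G \<longleftrightarrow>
     subgraph_of G M \<and>
     card (edges G) = n \<and>
     (\<forall>F\<in>faces S M. card {e \<in> edges G. e \<subseteq> face_boundary M F} = 2) \<and>
     (\<exists>Fs. length Fs = n \<and> distinct Fs \<and> set Fs \<subseteq> faces S M \<and>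
        (\<forall>i. Suc i < n \<longrightarrow> Fs ! i \<inter> Fs ! Suc i \<in> edges G) \<and>
        Fs ! 0 \<inter> Fs ! (n - 1) \<in> edges G)"

definition proper_type_I :: "'a topology \<Rightarrow> 'a egraph \<Rightarrow> nat \<Rightarrow> 'a egraph \<Rightarrow> bool" where
  "proper_type_I S M n G \<longleftrightarrow>
     admissible S M n G \<and>
     egraph_connected \<lparr>verts = verts M, edges = edges M - edges G\<rparr>"

end

theory Submission
  imports Defs
begin

text \<open>
  Cycle edges \<open>C\<close> of \<open>K\<close> and edges of a subgraph \<open>G\<close> of \<open>M\<close> correspond under \<open>\<delta>\<close>. The condition on
  the sequence of faces asks that \<open>\<psi> u \<inter> \<psi> v\<close> be a single edge when \<open>u\<close> and \<open>v\<close> are adjacent in \<open>K\<close>;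
  although \<open>M\<close> is not assumed polyhedral, this follows from \<open>K\<close> being so, because a face of \<open>K\<close> that
  contains both ends of an edge contains the edge.

  The complement of the curve of a Hamiltonian cycle contains no vertex of \<open>K\<close>, so it is a union of
  the connected sets \<open>F - \<Union>C\<close>, one for each face \<open>F\<close> of \<open>K\<close>. Two of these meet exactly when the
  faces share an edge outside \<open>C\<close>, that is, when their dual vertices are adjacent in \<open>M\<close> without \<open>G\<close>.
  Since these finitely many sets are relatively closed, the complement is connected if and only if
  their adjacency graph is.
\<close>

section \<open>Cycles of simple graphs\<close>

lemma embedded_simple_graphD:
  assumes "embedded_simple_graph S K"
  shows "finite (verts K)"
    and "e \<in> edges K \<Longrightarrow> \<exists>g. embedding_map (top_of_set {0..1::real}) S g \<and>
      e = g ` {0..1} \<and> ends K e = {g 0, g 1}"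
    and "e \<in> edges K \<Longrightarrow> e' \<in> edges K \<Longrightarrow> e \<noteq> e' \<Longrightarrow> e \<inter> e' \<subseteq> verts K"
    and "e \<in> edges K \<Longrightarrow> e' \<in> edges K \<Longrightarrow> ends K e = ends K e' \<Longrightarrow> e = e'"
  using assms unfolding embedded_simple_graph_def by (elim conjE; erule bspec; assumption | simp)+

text \<open>Injectivity of the arc makes its ends distinct and keeps the image of 1/2 away from
  them, hence off all vertices. This inner point \<open>x\<close> is what later glues two faces
  together across an edge outside the cycle.\<close>

lemma embedded_edge:
  assumes "embedded_simple_graph S K" "e \<in> edges K"
  obtains a b x where "a \<noteq> b" "ends K e = {a, b}" "x \<in> e" "x \<notin> verts K" "e \<subseteq> topspace S"
proof -
  obtain g where g: "embedding_map (top_of_set {0..1::real}) S g" "e = g ` {0..1}"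
      "ends K e = {g 0, g 1}"
    using embedded_simple_graphD(2)[OF assms] by blast
  have inj: "inj_on g {0..1}"
    using homeomorphic_imp_injective_map g(1) by (fastforce simp: embedding_map_def)
  have "continuous_map (top_of_set {0..1::real}) S g"
    using g(1) embedding_map_def homeomorphic_imp_continuous_map continuous_map_in_subtopology
    by blast
  then have sub: "e \<subseteq> topspace S"
    using g(2) continuous_map_image_subset_topspace by fastforce
  have "g 0 \<noteq> g 1" "g (1/2) \<noteq> g 0" "g (1/2) \<noteq> g 1"
    using inj by (auto dest: inj_onD)
  moreover have "g (1/2) \<in> e"
    using g(2) by auto
  ultimately have "g (1/2) \<notin> verts K"
    using g(3) by (auto simp: ends_def)
  then show ?thesis
    using that[OF \<open>g 0 \<noteq> g 1\<close> g(3) \<open>g (1/2) \<in> e\<close> _ sub] by blast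
qed

text \<open>Inverts the cyclic successor; the case split gives 0 the predecessor
  \<open>n - 1\<close>.\<close>

lemma Suc_mod_eq_iff:
  assumes "i < n" "j < n"
  shows "Suc j mod n = i \<longleftrightarrow> j = (if i = 0 then n - 1 else i - 1)"
proof (cases "Suc j = n")
  case False
  then have "Suc j mod n = Suc j" using assms by simp
  then show ?thesis using assms False by auto
qed (use assms in auto)

lemma graph_cycle_edge_indexing:
  assumes simple: "embedded_simple_graph S K" and cyc: "graph_cycle K vs"
  obtains E where "bij_betw E {..<length vs} (cycle_edges K vs)"
    "\<And>i. i < length vs \<Longrightarrow> ends K (E i) = {vs ! i, vs ! (Suc i mod length vs)}"
proof -
  let ?n = "length vs"
  have n: "?n \<ge> 3" and d: "distinct vs"
    and ex: "\<And>i. i < ?n \<Longrightarrow> \<exists>e\<in>edges K. ends K e = {vs ! i, vs ! (Suc i mod ?n)}"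
    using cyc by (auto simp: graph_cycle_def)
  then obtain E where E: "\<And>i. i < ?n \<Longrightarrow> E i \<in> edges K"
      "\<And>i. i < ?n \<Longrightarrow> ends K (E i) = {vs ! i, vs ! (Suc i mod ?n)}"
    by metis
  have inj: "inj_on E {..<?n}"
  proof (rule inj_onI, rule ccontr)
    fix i j assume ij: "i \<in> {..<?n}" "j \<in> {..<?n}" "E i = E j" "i \<noteq> j"
    have s: "Suc i mod ?n < ?n" "Suc j mod ?n < ?n"
      using n by (auto intro!: mod_less_divisor)
    \<comment> \<open>Two indices with the same edge would each be the cyclic successor of the
      other, which a length of at least 3 excludes.\<close>
    have "{vs ! i, vs ! (Suc i mod ?n)} = {vs ! j, vs ! (Suc j mod ?n)}"
      using E(2)[of i] E(2)[of j] ij by simp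
    then have "vs ! i = vs ! (Suc j mod ?n)" "vs ! j = vs ! (Suc i mod ?n)"
      using ij d by (auto simp: doubleton_eq_iff nth_eq_iff_index_eq)
    then have "i = Suc j mod ?n" "j = Suc i mod ?n"
      using nth_eq_iff_index_eq[OF d] ij(1,2) s by auto
    then have "j = (if i = 0 then ?n - 1 else i - 1)" "i = (if j = 0 then ?n - 1 else j - 1)"
      using Suc_mod_eq_iff[of i ?n j] Suc_mod_eq_iff[of j ?n i] ij(1,2) by auto
    then have "i = 0 \<and> j = ?n - 1 \<or> Suc j = i" "j = 0 \<and> i = ?n - 1 \<or> Suc i = j"
      by (cases "i = 0"; cases "j = 0"; force)+
    then show False using n ij(4) by linarith
  qed
  have "E ` {..<?n} = cycle_edges K vs"
  proof
    show "E ` {..<?n} \<subseteq> cycle_edges K vs"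
      using E unfolding cycle_edges_def by blast
    show "cycle_edges K vs \<subseteq> E ` {..<?n}"
    proof
      fix e assume "e \<in> cycle_edges K vs"
      then obtain i where "e \<in> edges K" "i < ?n" "ends K e = {vs ! i, vs ! (Suc i mod ?n)}"
        by (auto simp: cycle_edges_def)
      then have "e = E i"
        using embedded_simple_graphD(4)[OF simple] E by simp
      then show "e \<in> E ` {..<?n}" using \<open>i < ?n\<close> by blast
    qed
  qed
  then show ?thesis
    using that[of E] inj E(2) by (auto simp: bij_betw_def)
qed

lemma card_cycle_edges:
  assumes "embedded_simple_graph S K" "graph_cycle K vs"
  shows "card (cycle_edges K vs) = length vs"
  using graph_cycle_edge_indexing[OF assms] by (metis bij_betw_same_card card_lessThan)

lemma card_cycle_edges_at:
  assumes "embedded_simple_graph S K" and cyc: "graph_cycle K vs" and v: "v \<in> set vs"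
  shows "card {e \<in> cycle_edges K vs. v \<in> ends K e} = 2"
proof -
  let ?n = "length vs"
  obtain E where E: "bij_betw E {..<?n} (cycle_edges K vs)"
      "\<And>i. i < ?n \<Longrightarrow> ends K (E i) = {vs ! i, vs ! (Suc i mod ?n)}"
    using graph_cycle_edge_indexing[OF assms(1,2)] by metis
  have n: "?n \<ge> 3" and d: "distinct vs"
    using cyc by (auto simp: graph_cycle_def)
  obtain i where i: "i < ?n" "v = vs ! i"
    using v by (auto simp: in_set_conv_nth)
  \<comment> \<open>The cyclic predecessor of \<open>i\<close>: the edges at \<open>v\<close> are
    exactly \<open>E i\<close> and \<open>E ?p\<close>.\<close>
  let ?p = "if i = 0 then ?n - 1 else i - 1"
  have at: "v \<in> ends K (E j) \<longleftrightarrow> j \<in> {i, ?p}" if "j < ?n" for j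
  proof -
    have "Suc j mod ?n < ?n"
      using n by (auto intro!: mod_less_divisor)
    then have "v \<in> ends K (E j) \<longleftrightarrow> i = j \<or> i = Suc j mod ?n"
      using E(2)[OF that] i that nth_eq_iff_index_eq[OF d] by auto
    then show ?thesis
      using Suc_mod_eq_iff[OF i(1) that] by auto
  qed
  have p: "{i, ?p} \<subseteq> {..<?n}" using i by auto
  have "{e \<in> cycle_edges K vs. v \<in> ends K e} = E ` {j \<in> {..<?n}. v \<in> ends K (E j)}"
    by (auto simp flip: bij_betw_imp_surj_on[OF E(1)])
  also have "{j \<in> {..<?n}. v \<in> ends K (E j)} = {i, ?p}"
    using at p by blast
  finally have "card {e \<in> cycle_edges K vs. v \<in> ends K e} = card {i, ?p}"
    using E(1) p by (metis (no_types, lifting) bij_betw_def card_image inj_on_subset)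
  then show ?thesis using n i by (auto simp: card_insert_if)
qed

section \<open>Cells and faces\<close>

lemma open_cellD:
  assumes "C \<in> open_cells S K"
  shows "C \<noteq> {}" "C \<subseteq> topspace S" "C \<inter> skeleton K = {}" "connectedin S C"
proof -
  have "C \<in> connected_components_of (subtopology S (topspace S - skeleton K))"
    using assms by (simp add: open_cells_def)
  note c = this nonempty_connected_components_of[OF this] connectedin_connected_components_of[OF this]
    connected_components_of_subset[OF this]
  show "C \<noteq> {}" "C \<subseteq> topspace S" "C \<inter> skeleton K = {}" "connectedin S C"
    using c by (auto simp: connectedin_subtopology)
qed

lemma open_cells_disjoint:
  assumes "C \<in> open_cells S K" "C' \<in> open_cells S K" "C \<noteq> C'"
  shows "C \<inter> C' = {}"
  using assms pairwise_disjoint_connected_components_of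
  by (fastforce simp: open_cells_def pairwise_def disjnt_def)

lemma cycle_curve_subset_skeleton: "cycle_curve K vs \<subseteq> skeleton K"
  by (auto simp: cycle_curve_def cycle_edges_def skeleton_def)

text \<open>The homeomorphism carries the splitting of the closed disc into open disc and circle
  over to the face. Since the open cell misses the skeleton, the boundary of the face is precisely
  the image of the circle.\<close>

lemma face_decomposition:
  assumes "surface_map S K" "F \<in> faces S K"
  obtains C vs where "C \<in> open_cells S K" "F = S closure_of C" "graph_cycle K vs"
    "F = C \<union> cycle_curve K vs" "face_boundary K F = cycle_curve K vs"
proof -
  obtain C where C: "C \<in> open_cells S K" "F = S closure_of C"
    using assms(2) by (auto simp: faces_def)
  then obtain h vs where h:
    "homeomorphic_map (top_of_set (cball (0::real^2) 1)) (subtopology S (S closure_of C)) h"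
    "h ` ball 0 1 = C" "graph_cycle K vs" "h ` sphere 0 1 = cycle_curve K vs"
    using assms(1) unfolding surface_map_def polygonal_disc_cell_def by metis
  have "h ` cball 0 1 = F"
    using homeomorphic_imp_surjective_map[OF h(1)] C(2) closure_of_subset_topspace[of S C]
    by (simp add: inf_absorb2)
  moreover have "cball (0::real^2) 1 = ball 0 1 \<union> sphere 0 1"
    by auto
  ultimately have F: "F = C \<union> cycle_curve K vs"
    using h(2,4) by (simp add: image_Un)
  have "face_boundary K F = cycle_curve K vs"
    using F cycle_curve_subset_skeleton[of K vs] open_cellD(3)[OF C(1)] by (auto simp: face_boundary_def)
  with that C h(3) F show ?thesis by blast
qed

lemma faces_closedin: "F \<in> faces S K \<Longrightarrow> closedin S F"
  by (auto simp: faces_def)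

text \<open>Different faces have disjoint open cells, so a common point lies on one of the two
  boundary cycles.\<close>

lemma faces_Int_subset_skeleton:
  assumes "surface_map S K" "F \<in> faces S K" "F' \<in> faces S K" "F \<noteq> F'"
  shows "F \<inter> F' \<subseteq> skeleton K"
proof -
  obtain C vs where C: "C \<in> open_cells S K" "F = S closure_of C" "F = C \<union> cycle_curve K vs"
    using face_decomposition[OF assms(1,2)] by metis
  obtain C' vs' where C': "C' \<in> open_cells S K" "F' = S closure_of C'" "F' = C' \<union> cycle_curve K vs'"
    using face_decomposition[OF assms(1,3)] by metis
  have "C \<inter> C' = {}"
    using open_cells_disjoint C C' assms(4) by blast
  then show ?thesis
    using C(3) C'(3) cycle_curve_subset_skeleton[of K vs] cycle_curve_subset_skeleton[of K vs']
    by blast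
qed

lemma edge_subset_face_boundary_iff:
  "e \<in> edges K \<Longrightarrow> e \<subseteq> face_boundary K F \<longleftrightarrow> e \<subseteq> F"
  by (auto simp: face_boundary_def skeleton_def)

lemma face_boundary_point_on_edge:
  assumes "surface_map S K" "F \<in> faces S K" "x \<in> face_boundary K F"
  obtains e where "e \<in> edges K" "e \<subseteq> face_boundary K F" "x \<in> e"
proof -
  obtain vs where "face_boundary K F = cycle_curve K vs"
    using face_decomposition[OF assms(1,2)] by metis
  then show ?thesis
    using assms(3) that by (fastforce simp: cycle_curve_def cycle_edges_def)
qed

lemma face_card_verts_ge_3:
  assumes "surface_map S K" "F \<in> faces S K"
  shows "card (verts K) \<ge> 3"
proof -
  obtain vs where "graph_cycle K vs"
    using face_decomposition[OF assms] by metis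
  moreover have "finite (verts K)"
    using assms(1) embedded_simple_graphD(1) unfolding surface_map_def by blast
  ultimately show ?thesis
    unfolding graph_cycle_def by (metis card_mono distinct_card le_trans)
qed

lemma point_off_skeleton_in_face:
  assumes "x \<in> topspace S - skeleton K"
  obtains F where "F \<in> faces S K" "x \<in> F"
proof -
  let ?X = "subtopology S (topspace S - skeleton K)"
  have "x \<in> topspace ?X" using assms by simp
  then obtain C where C: "C \<in> connected_components_of ?X" "x \<in> C"
    by (metis Union_connected_components_of UnionE)
  then have "C \<in> open_cells S K" by (simp add: open_cells_def)
  then have "S closure_of C \<in> faces S K" "x \<in> S closure_of C"
    using C(2) closure_of_subset[OF open_cellD(2)] by (auto simp: faces_def)
  then show ?thesis using that by blast
qed

lemma hamiltonian_verts_on_curve: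
  assumes "hamiltonian_cycle K vs"
  shows "verts K \<subseteq> cycle_curve K vs"
proof
  fix v assume "v \<in> verts K"
  then obtain i where "i < length vs" "v = vs ! i"
    using assms by (metis hamiltonian_cycle_def in_set_conv_nth)
  moreover obtain e where "e \<in> edges K" "ends K e = {vs ! i, vs ! (Suc i mod length vs)}"
    using assms \<open>i < length vs\<close> by (auto simp: hamiltonian_cycle_def graph_cycle_def)
  ultimately show "v \<in> cycle_curve K vs"
    by (fastforce simp: cycle_curve_def cycle_edges_def ends_def)
qed

lemma edge_Int_cycle_curve:
  assumes "embedded_simple_graph S K" "e \<in> edges K" "e \<notin> cycle_edges K vs"
  shows "e \<inter> cycle_curve K vs \<subseteq> verts K"
proof -
  have "e \<inter> d \<subseteq> verts K" if "d \<in> cycle_edges K vs" for d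
    using that assms embedded_simple_graphD(3)[OF assms(1,2), of d] by (auto simp: cycle_edges_def)
  then show ?thesis by (auto simp: cycle_curve_def)
qed

section \<open>Duality\<close>

text \<open>Fixes one choice of the three bijections whose existence \<open>dual_map\<close>
  asserts.\<close>

locale dual_pair =
  fixes S :: "'a topology" and K M :: "'a egraph"
    and \<phi> :: "'a set \<Rightarrow> 'a" and \<delta> :: "'a set \<Rightarrow> 'a set" and \<psi> :: "'a \<Rightarrow> 'a set"
  assumes surface: "surface S"
    and poly: "polyhedral_map S K"
    and M: "surface_map S M"
    and phi: "bij_betw \<phi> (faces S K) (verts M)"
    and delta: "bij_betw \<delta> (edges K) (edges M)"
    and psi: "bij_betw \<psi> (verts K) (faces S M)"
    and ends_delta: "e \<in> edges K \<Longrightarrow> ends M (\<delta> e) = \<phi> ` {F \<in> faces S K. e \<subseteq> face_boundary K F}"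
    and delta_psi: "e \<in> edges K \<Longrightarrow> v \<in> verts K \<Longrightarrow> \<delta> e \<subseteq> face_boundary M (\<psi> v) \<longleftrightarrow> v \<in> ends K e"
begin

lemma K: "surface_map S K"
  using poly by (simp add: polyhedral_map_def)

lemma graphs: "embedded_simple_graph S K" "embedded_simple_graph S M"
  using K M by (auto simp: surface_map_def)

lemma delta_edges: "e \<in> edges K \<Longrightarrow> \<delta> e \<in> edges M"
  using delta by (auto simp: bij_betw_def)

lemma psi_faces: "v \<in> verts K \<Longrightarrow> \<psi> v \<in> faces S M"
  using psi by (auto simp: bij_betw_def)

lemma dual_edge_cases:
  assumes "d \<in> edges M"
  obtains e where "e \<in> edges K" "d = \<delta> e"
  using assms delta unfolding bij_betw_def by blast

lemma dual_face_cases: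
  assumes "F \<in> faces S M"
  obtains v where "v \<in> verts K" "F = \<psi> v"
  using assms psi unfolding bij_betw_def by blast

lemma finite_faces: "finite (faces S K)"
  using bij_betw_finite[OF phi] embedded_simple_graphD(1)[OF graphs(2)] by simp

text \<open>Obtained from duality: the arc \<open>\<delta> e\<close> has two distinct ends, and
  these are the images of the faces at \<open>e\<close> under the injective map
  \<open>\<phi>\<close>.\<close>

lemma edge_faces:
  assumes "e \<in> edges K"
  obtains F F' where "F \<noteq> F'" "{F \<in> faces S K. e \<subseteq> face_boundary K F} = {F, F'}"
proof -
  let ?X = "{F \<in> faces S K. e \<subseteq> face_boundary K F}"
  obtain a b where "a \<noteq> b" "ends M (\<delta> e) = {a, b}"
    using embedded_edge[OF graphs(2) delta_edges[OF assms]] by metis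
  then have "card (\<phi> ` ?X) = 2"
    using ends_delta[OF assms] by simp
  moreover have "inj_on \<phi> ?X"
    using phi by (auto simp: bij_betw_def inj_on_def)
  ultimately have "card ?X = 2" by (simp add: card_image)
  then show ?thesis using that by (auto simp: card_2_iff)
qed

lemma edge_in_face:
  assumes "e \<in> edges K"
  obtains F where "F \<in> faces S K" "e \<subseteq> F"
proof -
  obtain F F' where "{F \<in> faces S K. e \<subseteq> face_boundary K F} = {F, F'}"
    using edge_faces[OF assms] by metis
  then have "F \<in> faces S K" "e \<subseteq> F"
    by (auto simp: face_boundary_def set_eq_iff)
  then show ?thesis by (rule that)
qed

lemma ends_delta_eq:
  assumes "e \<in> edges K" "F \<in> faces S K" "F' \<in> faces S K" "F \<noteq> F'" "e \<subseteq> F" "e \<subseteq> F'"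
  shows "ends M (\<delta> e) = {\<phi> F, \<phi> F'}"
proof -
  have "F \<in> {F \<in> faces S K. e \<subseteq> face_boundary K F}" "F' \<in> {F \<in> faces S K. e \<subseteq> face_boundary K F}"
    using assms by (auto simp: edge_subset_face_boundary_iff)
  then have "{F \<in> faces S K. e \<subseteq> face_boundary K F} = {F, F'}"
    using edge_faces[OF assms(1)] assms(4) by (metis doubleton_eq_iff insertE singletonD)
  then show ?thesis using ends_delta[OF assms(1)] by simp
qed

text \<open>Without vertices the skeleton is empty and any point of the surface lies in a face.
  Otherwise a vertex \<open>v\<close> gives a face \<open>\<psi> v\<close> of \<open>M\<close>,
  hence vertices of \<open>M\<close>, and \<open>\<phi>\<close> turns these into faces of
  \<open>K\<close>.\<close>

lemma faces_nonempty: "faces S K \<noteq> {}"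
proof (cases "verts K = {}")
  case True
  then have "edges K = {}"
    using embedded_edge[OF graphs(1)] by (metis Int_empty_right empty_not_insert ends_def equals0I)
  then have "skeleton K = {}" using True by (simp add: skeleton_def)
  moreover obtain x where "x \<in> topspace S"
    using surface unfolding surface_def by (meson ex_in_conv)
  ultimately show ?thesis using point_off_skeleton_in_face[of x S K] by (metis Diff_empty empty_iff)
next
  case False
  then have "card (verts M) \<ge> 3"
    using psi_faces face_card_verts_ge_3[OF M] by blast
  then show ?thesis
    using phi by (metis bij_betw_empty1 card.empty not_numeral_le_zero)
qed

text \<open>Excludes degenerate face sequences, in which the closing pair would be a single face or
  repeat a consecutive pair.\<close>

lemma card_verts_ge_3: "card (verts K) \<ge> 3"
  using faces_nonempty face_card_verts_ge_3[OF K] by blast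

section \<open>Intersections of dual faces\<close>

text \<open>A face \<open>F'\<close> containing \<open>e\<close> and different from \<open>F\<close>
  shares two vertices with \<open>F\<close>. As \<open>K\<close> is polyhedral,
  \<open>F \<inter> F'\<close> is then an edge; it has the same ends as \<open>e\<close>, so it is
  \<open>e\<close> because the graph is simple.\<close>

lemma edge_subset_face:
  assumes e: "e \<in> edges K" "ends K e = {u, v}" "u \<noteq> v" and F: "F \<in> faces S K" "u \<in> F" "v \<in> F"
  shows "e \<subseteq> F"
proof -
  obtain F' where F': "F' \<in> faces S K" "e \<subseteq> F'"
    by (rule edge_in_face[OF e(1)])
  have uv: "u \<in> e" "v \<in> e" "u \<in> verts K" "v \<in> verts K"
    using e(2) by (auto simp: ends_def)
  show ?thesis
  proof (cases "F = F'")
    case False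
    have "u \<in> F \<inter> F'" "v \<in> F \<inter> F'" using uv F F' by auto
    then have FF': "F \<inter> F' \<in> edges K"
      using poly False F(1) F'(1) e(3) unfolding polyhedral_map_def by (metis empty_iff singletonD)
    obtain a b where "ends K (F \<inter> F') = {a, b}"
      using embedded_edge[OF graphs(1) FF'] by metis
    moreover have "u \<in> ends K (F \<inter> F')" "v \<in> ends K (F \<inter> F')"
      using uv F F' by (auto simp: ends_def)
    ultimately have "ends K (F \<inter> F') = {u, v}" using e(3) by auto
    then have "F \<inter> F' = e"
      using embedded_simple_graphD(4)[OF graphs(1) FF' e(1)] e(2) by simp
    then show ?thesis by blast
  qed (use F' in auto)
qed

text \<open>The vertex \<open>\<phi> F\<close> lies on some dual edge \<open>\<delta> e\<close> in
  the boundary of \<open>\<psi> v\<close>. Then \<open>v\<close> is an end of \<open>e\<close>, and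
  \<open>e\<close> lies in \<open>F\<close> since \<open>\<phi>\<close> is injective.\<close>

lemma phi_in_psi:
  assumes "F \<in> faces S K" "v \<in> verts K" "\<phi> F \<in> \<psi> v"
  shows "v \<in> F"
proof -
  have "\<phi> F \<in> verts M" using phi assms(1) by (auto simp: bij_betw_def)
  then have "\<phi> F \<in> face_boundary M (\<psi> v)"
    using assms(3) by (simp add: face_boundary_def skeleton_def)
  then obtain d where "d \<in> edges M" "d \<subseteq> face_boundary M (\<psi> v)" "\<phi> F \<in> d"
    using face_boundary_point_on_edge[OF M psi_faces[OF assms(2)]] by metis
  moreover obtain e where e: "e \<in> edges K" "d = \<delta> e"
    using dual_edge_cases[OF \<open>d \<in> edges M\<close>] .
  ultimately have "v \<in> ends K e" "\<phi> F \<in> ends M (\<delta> e)"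
    using delta_psi[OF e(1) assms(2)] \<open>\<phi> F \<in> verts M\<close> by (auto simp: ends_def)
  then obtain F' where "F' \<in> faces S K" "e \<subseteq> face_boundary K F'" "\<phi> F = \<phi> F'"
    using ends_delta[OF e(1)] by auto
  then have "e \<subseteq> F"
    using phi assms(1) by (auto simp: bij_betw_def face_boundary_def dest: inj_onD)
  then show ?thesis using \<open>v \<in> ends K e\<close> by (auto simp: ends_def)
qed

text \<open>Translates adjacency in \<open>K\<close> into the condition on consecutive faces of an
  admissible graph.\<close>

lemma psi_Int_psi:
  assumes e: "e \<in> edges K" "ends K e = {u, v}" "u \<noteq> v"
  shows "\<psi> u \<inter> \<psi> v = \<delta> e"
proof
  have uv: "u \<in> verts K" "v \<in> verts K"
    using e(2) by (auto simp: ends_def)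
  then show "\<delta> e \<subseteq> \<psi> u \<inter> \<psi> v"
    using delta_psi[OF e(1)] e(2) by (auto simp: face_boundary_def)
  have ne: "\<psi> u \<noteq> \<psi> v"
    using psi uv e(3) by (auto simp: bij_betw_def dest: inj_onD)
  show "\<psi> u \<inter> \<psi> v \<subseteq> \<delta> e"
  proof
    fix x assume x: "x \<in> \<psi> u \<inter> \<psi> v"
    then have sk: "x \<in> skeleton M"
      using faces_Int_subset_skeleton[OF M psi_faces psi_faces ne] uv by blast
    show "x \<in> \<delta> e"
    proof (cases "x \<in> verts M")
      case True
      \<comment> \<open>A common vertex is dual to a face that contains \<open>u\<close> and
        \<open>v\<close>, hence all of \<open>e\<close>; so it is an end of
        \<open>\<delta> e\<close>.\<close>
      then obtain F where F: "F \<in> faces S K" "x = \<phi> F"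
        using phi by (auto simp: bij_betw_def)
      then have "e \<subseteq> F"
        using phi_in_psi x uv edge_subset_face[OF e F(1)] by blast
      then have "x \<in> ends M (\<delta> e)"
        using ends_delta[OF e(1)] F edge_subset_face_boundary_iff[OF e(1)] by auto
      then show ?thesis by (simp add: ends_def)
    next
      case False
      have "\<exists>d\<in>edges K. x \<in> \<delta> d \<and> w \<in> ends K d" if "w \<in> {u, v}" for w
      proof -
        have w: "w \<in> verts K" "x \<in> face_boundary M (\<psi> w)"
          using that uv x sk by (auto simp: face_boundary_def)
        obtain d where "d \<in> edges M" "d \<subseteq> face_boundary M (\<psi> w)" "x \<in> d"
          using face_boundary_point_on_edge[OF M psi_faces[OF w(1)] w(2)] by metis
        then show ?thesis
          using delta_psi[OF _ w(1)] dual_edge_cases[of d] by metis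
      qed
      then obtain d d' where d: "d \<in> edges K" "x \<in> \<delta> d" "u \<in> ends K d"
          "d' \<in> edges K" "x \<in> \<delta> d'" "v \<in> ends K d'"
        by blast
      \<comment> \<open>Distinct edges of \<open>M\<close> meet only in vertices, so the edges
        through \<open>x\<close> found for \<open>u\<close> and for \<open>v\<close> agree; their
        common dual joins \<open>u\<close> and \<open>v\<close>.\<close>
      have "\<delta> d = \<delta> d'"
        using embedded_simple_graphD(3)[OF graphs(2) delta_edges delta_edges] False d by blast
      then have dd': "d = d'"
        using delta d by (auto simp: bij_betw_def dest: inj_onD)
      obtain a b where "ends K d = {a, b}"
        using embedded_edge[OF graphs(1) d(1)] by metis
      then have "ends K d = {u, v}"
        using d dd' e(3) by auto
      then have "d = e"
        using embedded_simple_graphD(4)[OF graphs(1) d(1) e(1)] e(2) by simp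
      then show ?thesis using d by simp
    qed
  qed
qed

text \<open>A Hamiltonian cycle passes through every vertex, so only inner points of the other edges
  remain of the skeleton.\<close>

lemma off_curve_on_edge:
  assumes "hamiltonian_cycle K vs" "x \<in> skeleton K" "x \<notin> cycle_curve K vs"
  obtains e where "e \<in> edges K" "e \<notin> cycle_edges K vs" "x \<in> e" "x \<notin> verts K"
  using assms hamiltonian_verts_on_curve[OF assms(1)] unfolding skeleton_def cycle_curve_def by blast

lemma off_curve_in_face:
  assumes "hamiltonian_cycle K vs" "x \<in> topspace S" "x \<notin> cycle_curve K vs"
  obtains F where "F \<in> faces S K" "x \<in> F"
proof (cases "x \<in> skeleton K")
  case True
  then obtain e where e: "e \<in> edges K" "x \<in> e"
    using off_curve_on_edge assms by metis
  obtain F where "F \<in> faces S K" "e \<subseteq> F"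
    by (rule edge_in_face[OF e(1)])
  then show ?thesis using that e(2) by blast
next
  case False
  then show ?thesis using that assms(2) point_off_skeleton_in_face[of x S K] by blast
qed

section \<open>From a non-separating Hamiltonian cycle to a proper graph of type-I\<close>

abbreviation dual_complement :: "'a set set \<Rightarrow> 'a egraph" where
  "dual_complement E \<equiv> \<lparr>verts = verts M, edges = edges M - E\<rparr>"

lemma ends_dual_complement: "ends (dual_complement E) d = ends M d"
  by (simp add: ends_def)

lemma dual_complement_connected:
  assumes ham: "hamiltonian_cycle K vs" and conn: "\<not> separating S K vs"
  shows "egraph_connected (dual_complement (\<delta> ` cycle_edges K vs))"
proof -
  let ?Y = "topspace S - cycle_curve K vs"
  let ?R = "\<lambda>x y. \<exists>d\<in>edges M - \<delta> ` cycle_edges K vs. ends M d = {x, y}"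
  have "?R\<^sup>*\<^sup>* (\<phi> F0) (\<phi> F1)" if F0: "F0 \<in> faces S K" and F1: "F1 \<in> faces S K" for F0 F1
  proof (rule ccontr)
    assume no: "\<not> ?R\<^sup>*\<^sup>* (\<phi> F0) (\<phi> F1)"
    \<comment> \<open>The faces reachable from \<open>F0\<close> and the remaining ones have closed
      unions, by finiteness; these would disconnect \<open>?Y\<close>.\<close>
    define A where "A = {F \<in> faces S K. ?R\<^sup>*\<^sup>* (\<phi> F0) (\<phi> F)}"
    define B where "B = faces S K - A"
    have cl: "closedin S (\<Union>A)" "closedin S (\<Union>B)"
      using finite_faces faces_closedin
      by (auto intro!: closedin_Union intro: finite_subset simp: A_def B_def)
    have cover: "?Y \<subseteq> \<Union>A \<union> \<Union>B"
      using off_curve_in_face[OF ham] unfolding B_def by blast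
    have disj: "\<Union>A \<inter> \<Union>B \<inter> ?Y = {}"
    proof (rule ccontr)
      assume "\<Union>A \<inter> \<Union>B \<inter> ?Y \<noteq> {}"
      then obtain x F F' where x: "x \<in> ?Y" "F \<in> A" "x \<in> F" "F' \<in> B" "x \<in> F'" by blast
      have F: "F \<in> faces S K" "F' \<in> faces S K" "F \<noteq> F'"
        using x by (auto simp: A_def B_def)
      have "x \<in> skeleton K"
        using faces_Int_subset_skeleton[OF K F] x by blast
      then obtain e where e: "e \<in> edges K" "e \<notin> cycle_edges K vs" "x \<in> e" "x \<notin> verts K"
        using off_curve_on_edge[OF ham] x by blast
      \<comment> \<open>The common point \<open>x\<close> is not a vertex, so of the three cases
        allowed by polyhedrality only an edge is left. It contains the inner point \<open>x\<close>
        of \<open>e\<close>, so it is \<open>e\<close>, and \<open>\<delta> e\<close> links the two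
        classes.\<close>
      have "F \<inter> F' \<in> edges K"
        using poly F x e(4) unfolding polyhedral_map_def by (metis IntI empty_iff singletonD)
      then have "F \<inter> F' = e"
        using embedded_simple_graphD(3)[OF graphs(1) _ e(1)] e x by blast
      then have "ends M (\<delta> e) = {\<phi> F, \<phi> F'}"
        using ends_delta_eq[OF e(1) F] by blast
      moreover have "\<delta> e \<in> edges M - \<delta> ` cycle_edges K vs"
        using delta_edges[OF e(1)] e delta by (auto simp: bij_betw_def cycle_edges_def dest: inj_onD)
      ultimately have "?R (\<phi> F) (\<phi> F')" by blast
      moreover have "?R\<^sup>*\<^sup>* (\<phi> F0) (\<phi> F)" using x by (simp add: A_def)
      ultimately have "?R\<^sup>*\<^sup>* (\<phi> F0) (\<phi> F')" by (rule rtranclp.rtrancl_into_rtrancl[rotated])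
      then show False using x F by (simp add: A_def B_def)
    qed
    \<comment> \<open>The open cell of a face is nonempty and avoids the curve, so neither part of
      the splitting is empty.\<close>
    have meets: "F \<inter> ?Y \<noteq> {}" if "F \<in> faces S K" for F
    proof -
      obtain C where C: "C \<in> open_cells S K" "F = S closure_of C"
        using \<open>F \<in> faces S K\<close> by (auto simp: faces_def)
      show ?thesis
        using cycle_curve_subset_skeleton[of K vs] open_cellD[OF C(1)] closure_of_subset[OF open_cellD(2)[OF C(1)]] C(2) by blast
    qed
    have "F0 \<in> A" "F1 \<in> B"
      using F0 F1 no by (auto simp: A_def B_def)
    then have "\<Union>A \<inter> ?Y \<noteq> {}" "\<Union>B \<inter> ?Y \<noteq> {}"
      using meets F0 F1 by blast+
    moreover have "connectedin S ?Y"
      using conn by (simp add: separating_def)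
    ultimately show False
      using cl cover disj unfolding connectedin_closedin by blast
  qed
  then show ?thesis
    unfolding egraph_connected_def ends_dual_complement by (auto simp flip: bij_betw_imp_surj_on[OF phi])
qed

text \<open>The face sequence is the image of the cycle under \<open>\<psi>\<close>. The two edges
  required at each dual face are the duals of the two cycle edges at the corresponding
  vertex.\<close>

lemma proper_type_I_of_cycle:
  assumes ham: "hamiltonian_cycle K vs" and conn: "\<not> separating S K vs"
  shows "proper_type_I S M (card (verts K)) \<lparr>verts = verts M, edges = \<delta> ` cycle_edges K vs\<rparr>"
proof -
  let ?E = "cycle_edges K vs" and ?n = "length vs"
  have cyc: "graph_cycle K vs" and vs: "set vs = verts K"
    using ham by (auto simp: hamiltonian_cycle_def)
  then have d: "distinct vs" "?n \<ge> 3" by (auto simp: graph_cycle_def)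
  then have n: "card (verts K) = ?n" using vs by (metis distinct_card)
  have EK: "?E \<subseteq> edges K" by (auto simp: cycle_edges_def)
  then have inj: "inj_on \<delta> ?E"
    using delta by (auto simp: bij_betw_def intro: inj_on_subset)
  have card2: "card {d \<in> \<delta> ` ?E. d \<subseteq> face_boundary M F} = 2" if "F \<in> faces S M" for F
  proof -
    obtain v where v: "v \<in> verts K" "F = \<psi> v"
      using dual_face_cases \<open>F \<in> faces S M\<close> by blast
    have "{d \<in> \<delta> ` ?E. d \<subseteq> face_boundary M F} = \<delta> ` {e \<in> ?E. v \<in> ends K e}"
      using delta_psi v EK by auto
    moreover have "inj_on \<delta> {e \<in> ?E. v \<in> ends K e}"
      using inj by (rule inj_on_subset) auto
    ultimately show ?thesis
      using card_cycle_edges_at[OF graphs(1) cyc] v vs by (simp add: card_image)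
  qed
  have step: "\<psi> (vs ! i) \<inter> \<psi> (vs ! (Suc i mod ?n)) \<in> \<delta> ` ?E" if "i < ?n" for i
  proof -
    obtain e where e: "e \<in> edges K" "ends K e = {vs ! i, vs ! (Suc i mod ?n)}"
      using cyc \<open>i < ?n\<close> unfolding graph_cycle_def by blast
    obtain a b where "a \<noteq> b" "ends K e = {a, b}"
      using embedded_edge[OF graphs(1) e(1)] by metis
    then have "vs ! i \<noteq> vs ! (Suc i mod ?n)" using e(2) by auto
    then have "\<psi> (vs ! i) \<inter> \<psi> (vs ! (Suc i mod ?n)) = \<delta> e"
      using psi_Int_psi[OF e] by blast
    then show ?thesis using e that by (auto simp: cycle_edges_def)
  qed
  have "admissible S M ?n \<lparr>verts = verts M, edges = \<delta> ` ?E\<rparr>"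
    unfolding admissible_def
  proof (intro conjI exI)
    show "subgraph_of \<lparr>verts = verts M, edges = \<delta> ` ?E\<rparr> M"
      using EK delta_edges by (auto simp: subgraph_of_def ends_def)
    show "card (edges \<lparr>verts = verts M, edges = \<delta> ` ?E\<rparr>) = ?n"
      using card_cycle_edges[OF graphs(1) cyc] inj by (simp add: card_image)
    show "\<forall>F\<in>faces S M. card {d \<in> edges \<lparr>verts = verts M, edges = \<delta> ` ?E\<rparr>.
        d \<subseteq> face_boundary M F} = 2"
      using card2 by simp
    show "length (map \<psi> vs) = ?n" by simp
    show "distinct (map \<psi> vs)"
      using d vs psi by (simp add: distinct_map bij_betw_def)
    show "set (map \<psi> vs) \<subseteq> faces S M"
      using vs psi_faces by auto
    show "\<forall>i. Suc i < ?n \<longrightarrow>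
        map \<psi> vs ! i \<inter> map \<psi> vs ! Suc i \<in> edges \<lparr>verts = verts M, edges = \<delta> ` ?E\<rparr>"
    proof (intro allI impI)
      fix i assume "Suc i < ?n"
      then show "map \<psi> vs ! i \<inter> map \<psi> vs ! Suc i \<in> edges \<lparr>verts = verts M, edges = \<delta> ` ?E\<rparr>"
        using step[of i] by simp
    qed
    \<comment> \<open>At the last index the successor modulo \<open>?n\<close> is 0, which closes
      the face sequence.\<close>
    have "Suc (?n - 1) = ?n" using d by simp
    then have "\<psi> (vs ! (?n - 1)) \<inter> \<psi> (vs ! 0) \<in> \<delta> ` ?E"
      using step[of "?n - 1"] d by fastforce
    moreover have "map \<psi> vs ! 0 = \<psi> (vs ! 0)" "map \<psi> vs ! (?n - 1) = \<psi> (vs ! (?n - 1))"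
      using d by (auto intro!: nth_map)
    ultimately show "map \<psi> vs ! 0 \<inter> map \<psi> vs ! (?n - 1) \<in>
        edges \<lparr>verts = verts M, edges = \<delta> ` ?E\<rparr>"
      by (simp add: Int_commute)
  qed
  then show ?thesis
    using dual_complement_connected[OF assms] n by (simp add: proper_type_I_def)
qed

section \<open>From a proper graph of type-I to a non-separating Hamiltonian cycle\<close>

text \<open>A walk in the dual complement crosses only edges outside the cycle, and at each crossing
  the parts of the two faces off the curve share a point. Allowing any \<open>E\<close> that
  contains the dual cycle edges lets \<open>E\<close> be the edge set of a given proper
  graph.\<close>

lemma not_separating_of_dual_complement:
  assumes ham: "hamiltonian_cycle K vs" and E: "\<delta> ` cycle_edges K vs \<subseteq> E"
    and conn: "egraph_connected (dual_complement E)"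
  shows "\<not> separating S K vs"
proof -
  let ?Y = "topspace S - cycle_curve K vs"
  let ?P = "\<lambda>F. F \<inter> ?Y"
  let ?R = "\<lambda>x y. \<exists>d\<in>edges M - E. ends M d = {x, y}"
  note curve = cycle_curve_subset_skeleton[of K vs]
  have P: "connectedin S (?P F)" if F: "F \<in> faces S K" for F
  proof -
    obtain C where C: "C \<in> open_cells S K" "F = S closure_of C"
      using F by (auto simp: faces_def)
    \<comment> \<open>The part of a face off the curve lies between the connected open cell and its
      closure.\<close>
    have "C \<subseteq> ?P F"
      using open_cellD(2,3)[OF C(1)] closure_of_subset[OF open_cellD(2)[OF C(1)]] C(2) curve by blast
    then show ?thesis
      using connectedin_intermediate_closure_of[OF open_cellD(4)[OF C(1)]] C(2) by blast
  qed
  obtain F0 where F0: "F0 \<in> faces S K"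
    using faces_nonempty by blast
  \<comment> \<open>Induction along the walk: \<open>T\<close> collects the face parts passed so far
    and stays connected.\<close>
  have reach: "\<exists>F T. F \<in> faces S K \<and> x = \<phi> F \<and> connectedin S T \<and> T \<subseteq> ?Y \<and> ?P F0 \<subseteq> T \<and> ?P F \<subseteq> T"
    if "?R\<^sup>*\<^sup>* (\<phi> F0) x" for x
    using that
  proof (induction rule: rtranclp_induct)
    case base
    then show ?case using F0 P by blast
  next
    case (step x y)
    then obtain F T where FT: "F \<in> faces S K" "x = \<phi> F" "connectedin S T" "T \<subseteq> ?Y"
      "?P F0 \<subseteq> T" "?P F \<subseteq> T" by blast
    from step obtain d where d: "d \<in> edges M - E" "ends M d = {x, y}" by blast
    obtain e where e: "e \<in> edges K" "d = \<delta> e"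
      using dual_edge_cases d(1) by blast
    have "e \<notin> cycle_edges K vs" using d e E by blast
    \<comment> \<open>An inner point of the crossed edge lies off the curve and in both faces, so it
      joins \<open>T\<close> to the part of the next face.\<close>
    obtain p where p: "p \<in> e" "p \<notin> verts K" "e \<subseteq> topspace S"
      using embedded_edge[OF graphs(1) e(1)] by metis
    then have pY: "p \<in> ?Y"
      using edge_Int_cycle_curve[OF graphs(1) e(1) \<open>e \<notin> cycle_edges K vs\<close>] by blast
    have ends: "{x, y} = \<phi> ` {F \<in> faces S K. e \<subseteq> face_boundary K F}"
      using ends_delta[OF e(1)] d e by simp
    have end_face: "\<exists>F\<in>faces S K. e \<subseteq> F \<and> z = \<phi> F" if "z \<in> {x, y}" for z
      using that unfolding ends by (auto simp: face_boundary_def)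
    obtain F' where F': "F' \<in> faces S K" "e \<subseteq> F'" "y = \<phi> F'"
      using end_face[of y] by blast
    obtain F'' where "F'' \<in> faces S K" "e \<subseteq> F''" "x = \<phi> F''"
      using end_face[of x] by blast
    then have "e \<subseteq> F"
      using FT phi by (auto simp: bij_betw_def dest: inj_onD)
    then have "p \<in> T \<inter> ?P F'"
      using p pY F' FT by blast
    then have "connectedin S (T \<union> ?P F')"
      using connectedin_Un[OF FT(3) P[OF F'(1)]] by blast
    then show ?case
      using F' FT by (intro exI[of _ F'] exI[of _ "T \<union> ?P F'"]) auto
  qed
  \<comment> \<open>All these connected sets contain the nonempty set \<open>?P F0\<close>, so their
    union is connected; by \<open>reach\<close> it exhausts \<open>?Y\<close>.\<close>
  define \<T> where "\<T> = {T. connectedin S T \<and> T \<subseteq> ?Y \<and> ?P F0 \<subseteq> T}"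
  have "?P F0 \<noteq> {}"
  proof -
    obtain C where C: "C \<in> open_cells S K" "F0 = S closure_of C"
      using F0 by (auto simp: faces_def)
    then show ?thesis
      using open_cellD[OF C(1)] closure_of_subset[OF open_cellD(2)[OF C(1)]] curve by blast
  qed
  then have "connectedin S (\<Union>\<T>)"
    by (intro connectedin_Union) (auto simp: \<T>_def)
  moreover have "\<Union>\<T> = ?Y"
  proof
    show "\<Union>\<T> \<subseteq> ?Y" by (auto simp: \<T>_def)
    show "?Y \<subseteq> \<Union>\<T>"
    proof
      fix p assume p: "p \<in> ?Y"
      then obtain F where F: "F \<in> faces S K" "p \<in> F"
        using off_curve_in_face[OF ham] by blast
      have "\<phi> F0 \<in> verts M" "\<phi> F \<in> verts M"
        using phi F F0 by (auto simp: bij_betw_def)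
      then have "?R\<^sup>*\<^sup>* (\<phi> F0) (\<phi> F)"
        using conn unfolding egraph_connected_def ends_dual_complement by auto
      then obtain F' T where "F' \<in> faces S K" "\<phi> F = \<phi> F'" "T \<in> \<T>" "?P F' \<subseteq> T"
        using reach unfolding \<T>_def by blast
      then have "?P F \<subseteq> T" "T \<in> \<T>"
        using phi F(1) by (auto simp: bij_betw_def dest: inj_onD)
      then show "p \<in> \<Union>\<T>" using p F by blast
    qed
  qed
  ultimately show ?thesis by (simp add: separating_def)
qed

lemma cycle_of_proper_type_I:
  assumes "proper_type_I S M (card (verts K)) G"
  obtains vs where "hamiltonian_cycle K vs" "\<not> separating S K vs"
proof -
  let ?n = "card (verts K)"
  have sub: "edges G \<subseteq> edges M" and conn: "egraph_connected (dual_complement (edges G))"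
    using assms by (auto simp: proper_type_I_def admissible_def subgraph_of_def)
  obtain Fs where Fs: "length Fs = ?n" "distinct Fs" "set Fs \<subseteq> faces S M"
      "\<And>i. Suc i < ?n \<Longrightarrow> Fs ! i \<inter> Fs ! Suc i \<in> edges G" "Fs ! 0 \<inter> Fs ! (?n - 1) \<in> edges G"
    using assms unfolding proper_type_I_def admissible_def by blast
  have n: "?n \<ge> 3" by (rule card_verts_ge_3)
  \<comment> \<open>The sequence of distinct faces is pulled back along \<open>\<psi>\<close>. It
    has as many entries as \<open>K\<close> has vertices, so it visits all of them.\<close>
  define vs where "vs = map (inv_into (verts K) \<psi>) Fs"
  have inv: "bij_betw (inv_into (verts K) \<psi>) (faces S M) (verts K)"
    by (rule bij_betw_inv_into[OF psi])
  have len: "length vs = ?n" using Fs by (simp add: vs_def)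
  have dist: "distinct vs"
    using Fs inv by (auto simp: vs_def distinct_map bij_betw_def intro: inj_on_subset)
  have "set vs \<subseteq> verts K"
    using Fs inv by (auto simp: vs_def bij_betw_def)
  moreover have "card (set vs) = ?n"
    using dist len by (simp add: distinct_card)
  moreover have "finite (verts K)"
    using embedded_simple_graphD(1)[OF graphs(1)] .
  ultimately have set: "set vs = verts K"
    by (simp add: card_subset_eq)
  have psi_vs: "\<psi> (vs ! i) = Fs ! i" if "i < ?n" for i
  proof -
    have "Fs ! i \<in> \<psi> ` verts K"
      using that Fs psi by (auto simp: bij_betw_def)
    then show ?thesis
      using that Fs(1) by (simp add: vs_def f_inv_into_f)
  qed
  \<comment> \<open>Merges the conditions on consecutive faces and on the closing pair into one
    cyclic condition.\<close>
  have meet: "Fs ! i \<inter> Fs ! (Suc i mod ?n) \<in> edges G" if "i < ?n" for i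
  proof (cases "Suc i = ?n")
    case True
    then have "i = ?n - 1" "Suc i mod ?n = 0" by auto
    then show ?thesis using Fs(5) by (simp add: Int_commute)
  next
    case False
    then show ?thesis using Fs(4)[of i] that by simp
  qed
  have edge: "\<exists>e\<in>edges K. \<delta> e \<in> edges G \<and> ends K e = {vs ! i, vs ! (Suc i mod ?n)}" if "i < ?n" for i
  proof -
    let ?j = "Suc i mod ?n"
    have j: "?j < ?n" using n by (auto intro!: mod_less_divisor)
    note m = meet[OF that]
    have "?j \<noteq> i"
      using Suc_mod_eq_iff[OF that that] n by (auto split: if_splits)
    then have ne: "vs ! i \<noteq> vs ! ?j"
      using dist len that j by (simp add: nth_eq_iff_index_eq)
    \<comment> \<open>The shared edge of the two dual faces is dual to an edge that has both
      distinct vertices as ends.\<close>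
    obtain e where e: "e \<in> edges K" "\<delta> e = \<psi> (vs ! i) \<inter> \<psi> (vs ! ?j)"
      using dual_edge_cases subsetD[OF sub m] psi_vs[OF \<open>i < ?n\<close>] psi_vs[OF j] by metis
    have v: "vs ! i \<in> verts K" "vs ! ?j \<in> verts K"
      using set len that j by (metis nth_mem)+
    have "vs ! i \<in> ends K e" "vs ! ?j \<in> ends K e"
      using e v delta_psi[OF e(1)] edge_subset_face_boundary_iff[OF delta_edges[OF e(1)]] by blast+
    moreover obtain a b where "ends K e = {a, b}"
      using embedded_edge[OF graphs(1) e(1)] by metis
    ultimately have "ends K e = {vs ! i, vs ! ?j}" using ne by auto
    then show ?thesis
      using e m psi_vs[OF that] psi_vs[OF j] by metis
  qed
  have ham: "hamiltonian_cycle K vs"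
    unfolding hamiltonian_cycle_def graph_cycle_def len using n dist set edge by blast
  have "\<delta> ` cycle_edges K vs \<subseteq> edges G"
  proof
    fix d assume "d \<in> \<delta> ` cycle_edges K vs"
    then obtain e i where e: "d = \<delta> e" "e \<in> edges K" "i < ?n"
        "ends K e = {vs ! i, vs ! (Suc i mod ?n)}"
      by (auto simp: cycle_edges_def len)
    \<comment> \<open>\<open>edge\<close> yields some edge with the ends of \<open>e\<close> and
      dual in \<open>G\<close>; simplicity of \<open>K\<close> identifies it with
      \<open>e\<close>.\<close>
    then obtain e' where "e' \<in> edges K" "\<delta> e' \<in> edges G" "ends K e' = ends K e"
      using edge[OF e(3)] by auto
    moreover then have "e' = e"
      using embedded_simple_graphD(4)[OF graphs(1)] e(2) by blast
    ultimately show "d \<in> edges G" using e by simp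
  qed
  then show ?thesis
    using that ham not_separating_of_dual_complement[OF ham _ conn] by blast
qed

end

theorem theorem1:
  fixes S :: "'a topology" and K M :: "'a egraph" and n :: nat
  assumes "surface S"
    and "polyhedral_map S K"
    and "card (verts K) = n"
    and "dual_map S K M"
  shows "(\<exists>vs. hamiltonian_cycle K vs \<and> \<not> separating S K vs) \<longleftrightarrow>
         (\<exists>G. proper_type_I S M n G)"
proof -
  obtain \<phi> \<delta> \<psi> where "surface_map S M"
      "bij_betw \<phi> (faces S K) (verts M)"
      "bij_betw \<delta> (edges K) (edges M)"
      "bij_betw \<psi> (verts K) (faces S M)"
      "\<forall>e\<in>edges K. ends M (\<delta> e) = \<phi> ` {F \<in> faces S K. e \<subseteq> face_boundary K F}"
      "\<forall>e\<in>edges K. \<forall>v\<in>verts K. \<delta> e \<subseteq> face_boundary M (\<psi> v) \<longleftrightarrow> v \<in> ends K e"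
    using assms(4) unfolding dual_map_def by blast
  then interpret dual_pair S K M \<phi> \<delta> \<psi>
    using assms(1,2) by unfold_locales auto
  show ?thesis
    using proper_type_I_of_cycle cycle_of_proper_type_I assms(3) by metis
qed

end
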